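(* For every infinite sequence $\mathbf f\in\{-1,1\}^{\omega}$, the number of distinct factors of length $n$ of the run-length sequence $R_{\mathbf f}$ equals $4n+4$ for all $n\ge 6$.
   Context: For a finite sequence $\mathbf f$ over $\{-1,1\}$ define $P_\epsilon=\epsilon$ (empty) and $P_{\mathbf f a}=P_{\mathbf f}\ a\ (-P_{\mathbf f}^R)$ for $a\in\{-1,1\}$, where $-x$ negates every entry and $x^R$ is reversal. For an infinite $\mathbf f=f_0f_1\cdots$, $P_{\mathbf f}$ is the unique infinite sequence having every $P_{f_0\cdots f_n}$ as a prefix. A run is a maximal block of consecutive identical entries; the run-length sequence $R_{\mathbf f}$ is the infinite sequence of lengths of the runs of $P_{\mathbf f}$ from left to right. A factor is a contiguous block. *)

theory Defs
  imports Complex_Main "HOL-Library.Infinite_Set"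
begin

definition paperfold_word :: "int list \<Rightarrow> int list" where
  "paperfold_word fs = foldl (\<lambda>w a. w @ [a] @ map uminus (rev w)) [] fs"

lemma paperfold_word_Nil [simp]: "paperfold_word [] = []"
  by (simp add: paperfold_word_def)

lemma paperfold_word_snoc [simp]:
  "paperfold_word (fs @ [a]) = paperfold_word fs @ [a] @ map uminus (rev (paperfold_word fs))"
  by (simp add: paperfold_word_def)

definition prefix_of_seq :: "'a list \<Rightarrow> (nat \<Rightarrow> 'a) \<Rightarrow> bool" where
  "prefix_of_seq w s \<longleftrightarrow> w = map s [0..<length w]"

definition paperfold :: "(nat \<Rightarrow> int) \<Rightarrow> nat \<Rightarrow> int" where
  "paperfold f = (THE s. \<forall>n. prefix_of_seq (paperfold_word (map f [0..<Suc n])) s)"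

(* A maximal block of equal entries, of length l and starting at position i. *)
definition is_run :: "(nat \<Rightarrow> 'a) \<Rightarrow> nat \<Rightarrow> nat \<Rightarrow> bool" where
  "is_run s i l \<longleftrightarrow> 0 < l \<and> (\<forall>k<l. s (i + k) = s i) \<and> s (i + l) \<noteq> s i \<and>
     (i = 0 \<or> s (i - 1) \<noteq> s i)"

definition run_starts :: "(nat \<Rightarrow> 'a) \<Rightarrow> nat set" where
  "run_starts s = {i. \<exists>l. is_run s i l}"

(* Meaningful when s has infinitely many runs, so that enumerate lists their
   starting positions in increasing order; infinite_run_starts_paperfold below
   shows that this is the case for paperfolding sequences. *)
definition run_lengths :: "(nat \<Rightarrow> 'a) \<Rightarrow> nat \<Rightarrow> nat" where
  "run_lengths s k = (THE l. is_run s (enumerate (run_starts s) k) l)"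

definition factors :: "nat \<Rightarrow> (nat \<Rightarrow> 'a) \<Rightarrow> 'a list set" where
  "factors n s = {map s [i..<i + n] | i. True}"

lemma length_paperfold_word: "Suc (length (paperfold_word fs)) = 2 ^ length fs"
  by (induction fs rule: rev_induct) auto

lemma paperfold_word_nth_mono:
  assumes "m \<le> n" "i < length (paperfold_word (map f [0..<m]))"
  shows "i < length (paperfold_word (map f [0..<n])) \<and>
    paperfold_word (map f [0..<n]) ! i = paperfold_word (map f [0..<m]) ! i"
  using assms by (induction n rule: dec_induct) (auto simp: nth_append)

lemma less_length_paperfold_word: "i < length (paperfold_word (map f [0..<Suc i]))"
proof -
  have "Suc i < 2 ^ Suc i" by (rule less_exp)
  then show ?thesis using length_paperfold_word[of "map f [0..<Suc i]"] by simp
qed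

lemma nth_of_prefix:
  assumes "prefix_of_seq w s" "i < length w"
  shows "w ! i = s i"
proof -
  have "map s [0..<length w] ! i = s i" using assms(2) by simp
  then show ?thesis using assms(1) unfolding prefix_of_seq_def by simp
qed

lemma paperfold_ex1: "\<exists>!s. \<forall>n. prefix_of_seq (paperfold_word (map f [0..<Suc n])) s"
proof (rule ex1I)
  let ?s = "\<lambda>i. paperfold_word (map f [0..<Suc i]) ! i"
  have nth: "paperfold_word (map f [0..<Suc n]) ! i = ?s i"
    if len: "i < length (paperfold_word (map f [0..<Suc n]))" for n i
  proof (cases "n \<le> i")
    case True
    then have "Suc n \<le> Suc i" by (rule Suc_le_mono[THEN iffD2])
    from paperfold_word_nth_mono[OF this len] show ?thesis by (rule conjunct2[THEN sym])
  next
    case False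
    then have "Suc i \<le> Suc n" by (simp del: upt_Suc)
    from paperfold_word_nth_mono[OF this less_length_paperfold_word]
    show ?thesis by (rule conjunct2)
  qed
  show "\<forall>n. prefix_of_seq (paperfold_word (map f [0..<Suc n])) ?s"
    unfolding prefix_of_seq_def
  proof (intro allI nth_equalityI)
    fix n i
    let ?w = "paperfold_word (map f [0..<Suc n])"
    show "length ?w = length (map ?s [0..<length ?w])"
      by (simp only: length_map length_upt diff_zero)
    assume i: "i < length ?w"
    then have "map ?s [0..<length ?w] ! i = ?s i"
      by (simp only: nth_map nth_upt length_upt diff_zero add_0)
    with nth[OF i] show "?w ! i = map ?s [0..<length ?w] ! i" by (simp only:)
  qed
next
  fix s assume "\<forall>n. prefix_of_seq (paperfold_word (map f [0..<Suc n])) s"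
  then have "prefix_of_seq (paperfold_word (map f [0..<Suc i])) s" for i
    by blast
  then have "paperfold_word (map f [0..<Suc i]) ! i = s i" for i
    using less_length_paperfold_word[of i f] by (rule nth_of_prefix)
  then show "s = (\<lambda>i. paperfold_word (map f [0..<Suc i]) ! i)"
    by (intro ext) (simp only:)
qed

lemma prefix_paperfold: "prefix_of_seq (paperfold_word (map f [0..<n])) (paperfold f)"
proof (cases n)
  case 0
  then show ?thesis by (simp add: prefix_of_seq_def)
next
  case (Suc m)
  show ?thesis
    using theI'[OF paperfold_ex1[of f], rule_format, of m]
    unfolding Suc paperfold_def[symmetric] .
qed

lemma paperfold_nth:
  assumes "i < length (paperfold_word (map f [0..<n]))"
  shows "paperfold f i = paperfold_word (map f [0..<n]) ! i"
  using nth_of_prefix[OF prefix_paperfold assms] by simp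

lemma paperfold_mirror:
  assumes "i + 1 < 2 ^ n"
  shows "paperfold f (2 ^ Suc n - 2 - i) = - paperfold f i"
proof -
  let ?w = "paperfold_word (map f [0..<n])"
  let ?v = "paperfold_word (map f [0..<Suc n])"
  have L: "Suc (length ?w) = 2 ^ n" using length_paperfold_word[of "map f [0..<n]"] by simp
  have v: "?v = ?w @ [f n] @ map uminus (rev ?w)" by simp
  have j: "2 ^ Suc n - 2 - i = Suc (length ?w + (length ?w - Suc i))"
    using L assms by simp
  have i: "i < length ?w" using L assms by simp
  have lt: "2 ^ Suc n - 2 - i < length ?v" unfolding v j using i by simp
  have "?v ! (2 ^ Suc n - 2 - i) = - (?w ! i)"
  proof -
    have *: "(xs @ [a] @ ys) ! Suc (length xs + k) = ys ! k" for xs ys :: "int list" and a k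
      by (simp add: nth_append)
    have "length ?w - Suc i < length ?w" and "length ?w - Suc (length ?w - Suc i) = i"
      using i by auto
    then show ?thesis unfolding v j * by (simp add: rev_nth)
  qed
  then show ?thesis using paperfold_nth[OF lt] paperfold_nth[OF i] by simp
qed

lemma paperfold_values:
  assumes "\<And>i. f i \<in> {-1, 1}"
  shows "paperfold f i \<in> {-1, 1}"
proof -
  have "set (paperfold_word (map f [0..<n])) \<subseteq> {-1, 1}" for n
    using assms by (induction n) auto
  then show ?thesis
    using paperfold_nth[OF less_length_paperfold_word] nth_mem[OF less_length_paperfold_word]
    by (metis subsetD)
qed

lemma paperfold_not_eventually_constant:
  assumes "\<And>i. f i \<in> {-1, 1}"
  shows "\<exists>j>N. paperfold f j \<noteq> paperfold f N"
proof -
  let ?n = "Suc N"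
  have 1: "N + 1 < 2 ^ ?n" using less_exp[of ?n] by simp
  have "2 ^ Suc ?n - 2 - N > N" using 1 by simp
  moreover have "paperfold f (2 ^ Suc ?n - 2 - N) \<noteq> paperfold f N"
    using paperfold_mirror[OF 1, of f] paperfold_values[of f N, OF assms] by auto
  ultimately show ?thesis by blast
qed

lemma is_run_unique:
  assumes "is_run s i l" "is_run s i l'"
  shows "l = l'"
proof (cases l l' rule: linorder_cases)
  case less
  then show ?thesis using assms unfolding is_run_def by blast
next
  case greater
  then show ?thesis using assms unfolding is_run_def by blast
qed

lemma is_run_exists:
  assumes "i = 0 \<or> s (i - 1) \<noteq> s i" "\<exists>j>i. s j \<noteq> s i"
  shows "\<exists>l. is_run s i l"
proof -
  let ?P = "\<lambda>l. s (i + l) \<noteq> s i"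
  obtain j where "j > i" "s j \<noteq> s i" using assms(2) by blast
  then have "?P (j - i)" by simp
  then have "?P (LEAST l. ?P l)" by (rule LeastI)
  moreover from this have "(LEAST l. ?P l) > 0" by (metis add_0_right gr0I)
  ultimately show ?thesis
    unfolding is_run_def using assms(1) not_less_Least[of _ ?P] by blast
qed

lemma infinite_run_starts_paperfold:
  assumes "\<And>i. f i \<in> {-1, 1}"
  shows "infinite (run_starts (paperfold f))"
  unfolding infinite_nat_iff_unbounded
proof
  fix m
  let ?s = "paperfold f"
  let ?P = "\<lambda>j. j > m \<and> ?s j \<noteq> ?s m"
  obtain j where "?P j" using paperfold_not_eventually_constant[of f, OF assms] by blast
  define k where "k = (LEAST j. ?P j)"
  have k: "?P k" unfolding k_def by (rule LeastI) fact
  have "?s (k - 1) = ?s m"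
    using k not_less_Least[of "k - 1" ?P] unfolding k_def[symmetric]
    by (cases "k - 1 = m") auto
  then have "\<exists>l. is_run ?s k l"
    using k paperfold_not_eventually_constant[of f, OF assms] by (intro is_run_exists) auto
  then show "\<exists>n>m. n \<in> run_starts ?s" using k unfolding run_starts_def by blast
qed

lemma is_run_run_lengths:
  assumes "\<And>i. f i \<in> {-1, 1}"
  shows "is_run (paperfold f) (enumerate (run_starts (paperfold f)) k) (run_lengths (paperfold f) k)"
proof -
  have "enumerate (run_starts (paperfold f)) k \<in> run_starts (paperfold f)"
    by (intro enumerate_in_set infinite_run_starts_paperfold assms)
  then obtain l where l: "is_run (paperfold f) (enumerate (run_starts (paperfold f)) k) l"
    unfolding run_starts_def by blast
  show ?thesis unfolding run_lengths_def by (rule theI, rule l) (rule is_run_unique[OF _ l])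
qed

end

theory Submission
  imports Defs
begin

text \<open>With positions counted from 1, \<open>P\<^sub>f\<close> has the entry \<open>f\<^sub>k (-1)\<^sup>j\<close> at position
  \<open>2\<^sup>k (2j + 1)\<close>. Hence entries at consecutive odd positions differ, so between them there is exactly
  one boundary of runs, and its place is given by a sign \<open>U\<^sub>k\<close>. The sequence \<open>U\<close> is again a
  paperfolding sequence, and the run lengths are \<open>2 + (U\<^sub>k\<^sub>+\<^sub>1 - U\<^sub>k) / 2\<close>; so factors of length \<open>n\<close>
  of the run lengths correspond to factors of length \<open>n + 1\<close> of \<open>U\<close>.

  Count factors of a paperfolding sequence together with the parity of their position. Deinterleaving
  gives the recurrence \<open>D(n) = D(\<lfloor>n/2\<rfloor>) + D(\<lceil>n/2\<rceil>)\<close>, \<open>D(1) = 4\<close>, so \<open>D(n) = 4n\<close>. From length 7 on,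
  a factor determines the parity of its position.\<close>

section \<open>Closed form of the paperfolding entries\<close>

text \<open>Positions count from 1; the value at 0 is chosen such that the formula for the run lengths also
  holds for the first run.\<close>

fun pf :: "(nat \<Rightarrow> int) \<Rightarrow> nat \<Rightarrow> int" where
  "pf h m = (if m = 0 then 1 else if odd m then (-1) ^ (m div 2) * h 0
     else pf (\<lambda>k. h (Suc k)) (m div 2))"

declare pf.simps [simp del]

lemma pf_0 [simp]: "pf h 0 = 1"
  by (simp add: pf.simps)

lemma pf_odd: "pf h (Suc (2 * j)) = (-1) ^ j * h 0"
  by (subst pf.simps) simp

lemma pf_even: "pf h (2 * m) = pf (\<lambda>k. h (Suc k)) m"
  by (cases "m = 0") (simp, subst pf.simps, simp)

lemma pf_odd_add2:
  assumes "odd m"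
  shows "pf h (m + 2) = - pf h m"
proof -
  from assms obtain j where m: "m = Suc (2 * j)" by (auto elim: oddE)
  have "pf h (Suc (2 * Suc j)) = - pf h (Suc (2 * j))"
    unfolding pf_odd by simp
  then show ?thesis by (simp add: m)
qed

lemma pf_values:
  assumes "\<And>i. h i \<in> {-1, 1}"
  shows "pf h m \<in> {-1, 1}"
  using assms
proof (induction h m rule: pf.induct)
  case (1 h m)
  have "pf (\<lambda>k. h (Suc k)) (m div 2) \<in> {-1, 1}" if "m \<noteq> 0" "even m"
    using 1 that by simp
  moreover have "(-1 :: int) ^ (m div 2) \<in> {-1, 1}"
    using neg_one_even_power neg_one_odd_power by blast
  ultimately show ?case using "1.prems"[of 0] by (subst pf.simps) auto
qed

text \<open>Repeated halving of a positive position ends at an odd one, where the entry is linear in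
  the instruction; position 0 is excluded since its value is fixed at 1.\<close>

lemma pf_scale:
  assumes "m > 0"
  shows "pf (\<lambda>k. c * h k) m = c * pf h m"
  using assms
proof (induction h m rule: pf.induct)
  case (1 h m)
  then show ?case by (cases "odd m") (auto simp: pf.simps[of _ m] elim: evenE)
qed

lemma pf_pow2: "pf h (2 ^ n) = h n"
proof (induction n arbitrary: h)
  case 0
  show ?case using pf_odd[of h 0] by simp
next
  case (Suc n)
  then show ?case by (simp add: pf_even)
qed

text \<open>At even positions mirroring commutes with halving, so only odd positions need a
  computation.\<close>

lemma pf_mirror:
  assumes "0 < m" "m < 2 ^ n"
  shows "pf h (2 ^ Suc n - m) = - pf h m"
  using assms
proof (induction n arbitrary: h m)
  case 0
  then show ?case by simp
next
  case (Suc n)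
  show ?case
  proof (cases "even m")
    case True
    then obtain k where m: "m = 2 * k" by (auto elim: evenE)
    have "2 ^ Suc (Suc n) - m = 2 * (2 ^ Suc n - k)" by (simp add: m)
    then show ?thesis using Suc.IH[of k "\<lambda>k. h (Suc k)"] Suc.prems
      by (simp add: m pf_even del: power_Suc) simp
  next
    case False
    then obtain j where m: "m = Suc (2 * j)" by (auto elim: oddE)
    have j: "Suc j \<le> 2 ^ Suc n" using Suc.prems by (simp add: m)
    then have "2 ^ Suc (Suc n) - m = Suc (2 * (2 ^ Suc n - Suc j))" by (simp add: m)
    \<comment> \<open>\<open>2 ^ Suc n\<close> is even, so the reflected index has the parity
      opposite to that of \<open>j\<close> and the sign flips.\<close>
    moreover have "even (2 ^ Suc n - Suc j) \<longleftrightarrow> odd j" using j by simp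
    then have "(-1 :: int) ^ (2 ^ Suc n - Suc j) = - ((-1) ^ j)"
      by (cases "odd j") simp_all
    ultimately show ?thesis by (simp add: m pf_odd del: power_Suc)
  qed
qed

lemma paperfold_word_eq_pf:
  assumes "i + 1 < 2 ^ n"
  shows "paperfold_word (map f [0..<n]) ! i = pf f (Suc i)"
  using assms
proof (induction n arbitrary: i)
  case 0
  then show ?case by simp
next
  case (Suc n)
  let ?w = "paperfold_word (map f [0..<n])"
  have L: "Suc (length ?w) = 2 ^ n" using length_paperfold_word[of "map f [0..<n]"] by simp
  consider "i < length ?w" | "i = length ?w" | "i > length ?w" by linarith
  then show ?case
  proof cases
    case 1
    then show ?thesis using Suc.IH[of i] L by (simp add: nth_append)
  next
    case 2
    then show ?thesis using L by (simp add: pf_pow2)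
  next
    case 3
    \<comment> \<open>The mirror image of \<open>i\<close>: the last index of the longer word is
      \<open>2 ^ Suc n - 2\<close>.\<close>
    define k where "k = 2 ^ Suc n - 2 - i"
    have k: "k < length ?w" "Suc i = 2 ^ Suc n - Suc k" "length ?w - Suc (i - Suc (length ?w)) = k"
      "i - Suc (length ?w) < length ?w"
      using 3 L Suc.prems by (auto simp: k_def)
    have "paperfold_word (map f [0..<Suc n]) ! i = - (?w ! k)"
      using 3 k by (simp add: nth_append nth_Cons' rev_nth)
    also have "\<dots> = - pf f (Suc k)" using Suc.IH[of k] k L by simp
    also have "\<dots> = pf f (Suc i)" using pf_mirror[of "Suc k" n f] k L by simp
    finally show ?thesis .
  qed
qed

lemma paperfold_eq_pf: "paperfold f i = pf f (Suc i)"
  using paperfold_nth[OF less_length_paperfold_word, of f i]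
    paperfold_word_eq_pf[of i "Suc i" f] less_exp[of "Suc i"] by simp

section \<open>Counting factors of paperfolding sequences\<close>

text \<open>Composing \<open>b\<close> with a choice of preimages under \<open>a\<close> gives the
  bijection. This transfers cardinalities between sets of windows without an explicit map on
  lists.\<close>

lemma bij_betw_images_same_kernel:
  assumes "\<And>x y. x \<in> J \<Longrightarrow> y \<in> J \<Longrightarrow> a x = a y \<longleftrightarrow> b x = b y"
  shows "\<exists>\<phi>. bij_betw \<phi> (a ` J) (b ` J)"
proof -
  let ?g = "inv_into J a"
  have g: "b (?g (a x)) = b x" if "x \<in> J" for x
    using assms[of "?g (a x)" x] that by (simp add: f_inv_into_f inv_into_into)
  have "inj_on (b \<circ> ?g) (a ` J)" using g assms by (auto intro!: inj_onI)
  moreover have "(b \<circ> ?g) ` a ` J = b ` J" using g by (force simp: image_image)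
  ultimately show ?thesis unfolding bij_betw_def by blast
qed

lemma factors_eq_range: "factors n s = range (\<lambda>i. map s [i..<i + n])"
  by (auto simp: factors_def)

lemma window_eq_iff:
  "map s [i..<i + n] = map s [j..<j + n] \<longleftrightarrow> (\<forall>t<n. s (i + t) = s (j + t))"
  by (auto simp: list_eq_iff_nth_eq)

text \<open>The parity tag keeps apart the two ways of deinterleaving a window, which makes the
  recurrence exact.\<close>

definition pf_window :: "(nat \<Rightarrow> int) \<Rightarrow> nat \<Rightarrow> nat \<Rightarrow> bool \<times> int list" where
  "pf_window h n i = (even i, map (pf h) [i..<i + n])"

lemma pf_window_eq_iff:
  "pf_window h n i = pf_window h n j \<longleftrightarrow>
     (even i \<longleftrightarrow> even j) \<and> (\<forall>t<n. pf h (i + t) = pf h (j + t))"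
  by (simp add: pf_window_def window_eq_iff)

lemma neg_one_power_eq_iff: "(-1 :: int) ^ i = (-1) ^ j \<longleftrightarrow> (even i \<longleftrightarrow> even j)"
  by (cases "even i"; cases "even j") auto

text \<open>Even offsets carry \<open>(-1) ^ (i + s) * h 0\<close> and so record just the parity of
  \<open>i\<close>; odd offsets spell \<open>n div 2\<close> entries, from \<open>Suc i\<close> on,
  for the shifted instructions.\<close>

lemma pf_window_odd_eq_iff:
  assumes "h 0 \<noteq> 0" "n > 0"
  shows "pf_window h n (Suc (2 * i)) = pf_window h n (Suc (2 * j)) \<longleftrightarrow>
    pf_window (\<lambda>k. h (Suc k)) (n div 2) (Suc i) = pf_window (\<lambda>k. h (Suc k)) (n div 2) (Suc j)"
    (is "?L \<longleftrightarrow> ?R")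
proof
  let ?g = "\<lambda>k. h (Suc k)"
  have e: "pf h (Suc (2 * i) + 2 * s) = (-1) ^ (i + s) * h 0" for i s
    using pf_odd[of h "i + s"] by (simp add: algebra_simps)
  have o: "pf h (Suc (2 * i) + Suc (2 * s)) = pf ?g (Suc i + s)" for i s
    using pf_even[of h "Suc i + s"] by (simp add: algebra_simps)
  {
    assume ?L
    then have eq: "pf h (Suc (2 * i) + t) = pf h (Suc (2 * j) + t)" if "t < n" for t
      using that by (simp add: pf_window_eq_iff)
    have "even i = even j"
      using eq[of "2 * 0"] assms unfolding e by (simp add: neg_one_power_eq_iff)
    moreover have "pf ?g (Suc i + s) = pf ?g (Suc j + s)" if "s < n div 2" for s
    proof -
      have "Suc (2 * s) < n" using that by linarith
      then show ?thesis using eq unfolding o[symmetric] by blast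
    qed
    ultimately show ?R by (simp add: pf_window_eq_iff)
  next
    assume ?R
    then have par: "even i = even j" by (simp add: pf_window_eq_iff)
    have eq: "pf ?g (Suc i + s) = pf ?g (Suc j + s)" if "s < n div 2" for s
      using that \<open>?R\<close> by (simp add: pf_window_eq_iff)
    have "pf h (Suc (2 * i) + t) = pf h (Suc (2 * j) + t)" if t: "t < n" for t
    proof (cases "even t")
      case True
      then obtain s where s: "t = 2 * s" by (auto elim: evenE)
      have "(-1 :: int) ^ (i + s) = (-1) ^ (j + s)"
        using par by (simp add: neg_one_power_eq_iff)
      then show ?thesis unfolding s e by simp
    next
      case False
      then obtain s where s: "t = Suc (2 * s)" by (auto elim: oddE)
      then have "s < n div 2" using t by linarith
      then show ?thesis unfolding s o by (rule eq)
    qed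
    then show ?L by (simp add: pf_window_eq_iff)
  }
qed

text \<open>Here the odd offsets record the parity of \<open>i\<close>, and \<open>n > 1\<close>
  puts offset 1 into the window; the even offsets spell \<open>Suc n div 2\<close> entries from
  \<open>i\<close> on.\<close>

lemma pf_window_even_eq_iff:
  assumes "h 0 \<noteq> 0" "n > 1"
  shows "pf_window h n (2 * i) = pf_window h n (2 * j) \<longleftrightarrow>
    pf_window (\<lambda>k. h (Suc k)) (Suc n div 2) i = pf_window (\<lambda>k. h (Suc k)) (Suc n div 2) j"
    (is "?L \<longleftrightarrow> ?R")
proof
  let ?g = "\<lambda>k. h (Suc k)"
  have e: "pf h (2 * i + 2 * s) = pf ?g (i + s)" for i s
    using pf_even[of h "i + s"] by (simp add: algebra_simps)
  have o: "pf h (2 * i + Suc (2 * s)) = (-1) ^ (i + s) * h 0" for i s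
    using pf_odd[of h "i + s"] by (simp add: algebra_simps)
  {
    assume ?L
    then have eq: "pf h (2 * i + t) = pf h (2 * j + t)" if "t < n" for t
      using that by (simp add: pf_window_eq_iff)
    have "even i = even j"
      using eq[of "Suc (2 * 0)"] assms unfolding o by (simp add: neg_one_power_eq_iff)
    moreover have "pf ?g (i + s) = pf ?g (j + s)" if "s < Suc n div 2" for s
    proof -
      have "2 * s < n" using that by linarith
      then show ?thesis using eq unfolding e[symmetric] by blast
    qed
    ultimately show ?R by (simp add: pf_window_eq_iff)
  next
    assume ?R
    then have par: "even i = even j" by (simp add: pf_window_eq_iff)
    have eq: "pf ?g (i + s) = pf ?g (j + s)" if "s < Suc n div 2" for s
      using that \<open>?R\<close> by (simp add: pf_window_eq_iff)
    have "pf h (2 * i + t) = pf h (2 * j + t)" if t: "t < n" for t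
    proof (cases "even t")
      case True
      then obtain s where s: "t = 2 * s" by (auto elim: evenE)
      then have "s < Suc n div 2" using t by linarith
      then show ?thesis unfolding s e by (rule eq)
    next
      case False
      then obtain s where s: "t = Suc (2 * s)" by (auto elim: oddE)
      have "(-1 :: int) ^ (i + s) = (-1) ^ (j + s)"
        using par by (simp add: neg_one_power_eq_iff)
      then show ?thesis unfolding s o by simp
    qed
    then show ?L by (simp add: pf_window_eq_iff)
  }
qed

text \<open>Strong induction with arbitrary instructions, since halving a position shifts them.
  Position 0 is left out because its value is a convention.\<close>

lemma card_pf_windows:
  assumes "\<And>i. h i \<in> {-1, 1}" "n > 0"
  shows "finite (pf_window h n ` {1..}) \<and> card (pf_window h n ` {1..}) = 4 * n"
  using assms
proof (induction n arbitrary: h rule: less_induct)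
  case (less n)
  let ?g = "\<lambda>k. h (Suc k)"
  have h0: "h 0 = -1 \<or> h 0 = 1" and g0: "h 1 = -1 \<or> h 1 = 1"
    using less.prems(1)[of 0] less.prems(1)[of 1] by auto
  show ?case
  proof (cases "n = 1")
    case True
    \<comment> \<open>Positions 1 and 3 show both signs at odd positions, 2 and 6 both signs at even
      ones.\<close>
    have v: "pf h 1 = h 0" "pf h 3 = - h 0" "pf h 2 = h 1" "pf h 6 = - h 1"
      using pf_odd[of h 0] pf_odd[of h 1] pf_even[of h 1] pf_even[of h 3]
        pf_odd[of ?g 0] pf_odd[of ?g 1] by (simp_all add: numeral_eq_Suc)
    let ?A = "UNIV \<times> {[-1], [1]} :: (bool \<times> int list) set"
    have "pf_window h n ` {1..} \<subseteq> ?A"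
      using pf_values[of h, OF less.prems(1)] by (auto simp: pf_window_def True)
    moreover have "?A \<subseteq> pf_window h n ` {1, 3, 2, 6}"
      using h0 g0 v by (auto simp: pf_window_def True)
    ultimately have "pf_window h n ` {1..} = ?A" by (intro equalityI) (auto dest: subsetD)
    then show ?thesis by (simp add: True card_cartesian_product)
  next
    case False
    then have n: "n > 1" using less.prems by simp
    have g: "\<And>i. ?g i \<in> {-1, 1}" using less.prems by blast
    \<comment> \<open>Odd positions are listed as \<open>2 * i - 1\<close>, so that the halved
      window starts at \<open>i\<close> and the index set is again \<open>{1..}\<close>.\<close>
    let ?O = "(\<lambda>i. pf_window h n (Suc (2 * (i - 1)))) ` {1..}"
    let ?E = "(\<lambda>i. pf_window h n (2 * i)) ` {1..}"
    have split: "pf_window h n ` {1..} = ?O \<union> ?E"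
    proof
      show "?O \<union> ?E \<subseteq> pf_window h n ` {1..}" by auto
      show "pf_window h n ` {1..} \<subseteq> ?O \<union> ?E"
      proof
        fix x assume "x \<in> pf_window h n ` {1..}"
        then obtain i where i: "i \<ge> 1" "x = pf_window h n i" by auto
        show "x \<in> ?O \<union> ?E"
        proof (cases "even i")
          case True
          then obtain k where "i = 2 * k" by (auto elim: evenE)
          then show ?thesis using i by auto
        next
          case False
          then obtain k where "i = Suc (2 * (Suc k - 1))" by (auto elim: oddE)
          then have "x \<in> ?O" using i by (intro image_eqI[of _ _ "Suc k"]) auto
          then show ?thesis by blast
        qed
      qed
    qed
    have IH: "finite (pf_window ?g m ` {1..})" "card (pf_window ?g m ` {1..}) = 4 * m"
      if "0 < m" "m < n" for m
      using less.IH[OF that(2) g that(1)] by auto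
    have m: "0 < n div 2" "n div 2 < n" "0 < Suc n div 2" "Suc n div 2 < n"
      using n by linarith+
    have disj: "?O \<inter> ?E = {}" by (auto simp: pf_window_def)
    have "\<exists>\<phi>. bij_betw \<phi> (pf_window ?g (n div 2) ` {1..}) ?O"
    proof (rule bij_betw_images_same_kernel)
      fix i j :: nat
      assume "i \<in> {1..}" "j \<in> {1..}"
      then show "pf_window ?g (n div 2) i = pf_window ?g (n div 2) j \<longleftrightarrow>
          pf_window h n (Suc (2 * (i - 1))) = pf_window h n (Suc (2 * (j - 1)))"
        using pf_window_odd_eq_iff[of h n "i - 1" "j - 1"] h0 n by auto
    qed
    then have O: "finite ?O" "card ?O = 4 * (n div 2)"
      using IH[OF m(1,2)] bij_betw_finite bij_betw_same_card by metis+
    have "\<exists>\<phi>. bij_betw \<phi> (pf_window ?g (Suc n div 2) ` {1..}) ?E"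
      using pf_window_even_eq_iff[of h n] h0 n by (intro bij_betw_images_same_kernel) auto
    then have E: "finite ?E" "card ?E = 4 * (Suc n div 2)"
      using IH[OF m(3,4)] bij_betw_finite bij_betw_same_card by metis+
    have "n div 2 + Suc n div 2 = n" by linarith
    then show ?thesis unfolding split using O E disj by (simp add: card_Un_disjoint)
  qed
qed

section \<open>From windows with parity to plain factors\<close>

text \<open>Among the entries at even distances from the position, the first four alternate if the position
  is odd, and never if it is even.\<close>

lemma pf_window_parity:
  assumes h: "\<And>i. h i \<in> {-1, 1}" and "i > 0" "j > 0" "n \<ge> 7"
    and eq: "\<And>t. t < n \<Longrightarrow> pf h (i + t) = pf h (j + t)"
    and i: "even i"
  shows "even j"
proof (rule ccontr)
  assume "odd j"
  \<comment> \<open>The offsets 0, 2, 4 and 6 lie in the window, so the alternation from the odd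
    position \<open>j\<close> carries over to \<open>i\<close>.\<close>
  then have alt: "pf h (i + 2) = - pf h i" "pf h (i + 4) = - pf h (i + 2)"
    "pf h (i + 6) = - pf h (i + 4)"
    using pf_odd_add2[of j h] pf_odd_add2[of "j + 2" h] pf_odd_add2[of "j + 4" h] \<open>odd j\<close>
      eq[of 0] eq[of 2] eq[of 4] eq[of 6] \<open>n \<ge> 7\<close> by (simp_all add: add.assoc del: add_2_eq_Suc')
  obtain k where k: "i = 2 * k" using i by (auto elim: evenE)
  let ?v = "pf (\<lambda>k. h (Suc k))"
  have ev: "pf h (i + 2 * s) = ?v (k + s)" for s
    using pf_even[of h "k + s"] by (simp add: k distrib_left)
  have "pf h i = ?v k" "pf h (i + 2) = ?v (k + 1)" "pf h (i + 4) = ?v (k + 2)"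
    "pf h (i + 6) = ?v (k + 3)"
    using ev[of 0] ev[of 1] ev[of 2] ev[of 3] by simp_all
  moreover have k3: "k + 3 = k + 1 + 2" by simp
  \<comment> \<open>One of \<open>k\<close> and \<open>k + 1\<close> is odd, and from there two
    steps flip the sign; by \<open>alt\<close> entries of \<open>?v\<close> two steps apart would be
    equal.\<close>
  have "?v (k + 2) = - ?v k \<or> ?v (k + 3) = - ?v (k + 1)"
    using pf_odd_add2[of k "\<lambda>k. h (Suc k)"] pf_odd_add2[of "k + 1" "\<lambda>k. h (Suc k)"]
    unfolding k3 by (cases "odd k") auto
  ultimately have "?v k = 0" using alt by auto
  then show False using pf_values[of "\<lambda>k. h (Suc k)" k] h by force
qed

text \<open>Serves to replace an occurrence at position 0, where the value is a convention, by one
  at a positive position. If \<open>N\<close> works for the shifted instructions and half the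
  length, then \<open>2 * N\<close> works for \<open>h\<close>.\<close>

lemma pf_prefix_recurs:
  assumes "\<And>i. h i \<in> {-1, 1}" "c \<in> {-1, 1}"
  shows "\<exists>N>0. even N \<and> pf h N = c \<and> (\<forall>t. 0 < t \<and> t \<le> n \<longrightarrow> pf h (N + t) = pf h t)"
  using assms(1)
proof (induction n arbitrary: h rule: less_induct)
  case (less n)
  let ?g = "\<lambda>k. h (Suc k)"
  show ?case
  proof (cases "n = 0")
    case True
    have "pf h 2 = h 1" "pf h 6 = - h 1"
      using pf_even[of h 1] pf_even[of h 3] pf_odd[of ?g 0] pf_odd[of ?g 1]
      by (simp_all add: numeral_eq_Suc)
    moreover have "c = h 1 \<or> c = - h 1" using assms(2) less.prems[of 1] by auto
    ultimately have "pf h 2 = c \<or> pf h 6 = c" by auto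
    then show ?thesis
    proof
      assume "pf h 2 = c"
      then show ?thesis using True by (intro exI[of _ 2]) simp
    next
      assume "pf h 6 = c"
      then show ?thesis using True by (intro exI[of _ 6]) simp
    qed
  next
    case False
    then obtain N where N: "N > 0" "even N" "pf ?g N = c"
      and rec: "\<And>t. 0 < t \<Longrightarrow> t \<le> n div 2 \<Longrightarrow> pf ?g (N + t) = pf ?g t"
      using less.IH[of "n div 2" ?g] less.prems by auto
    have "pf h (2 * N + t) = pf h t" if t: "0 < t" "t \<le> n" for t
    proof (cases "even t")
      case True
      then obtain s where s: "t = 2 * s" by (auto elim: evenE)
      have "pf h (2 * (N + s)) = pf h (2 * s)"
        unfolding pf_even using t s by (intro rec) auto
      then show ?thesis by (simp add: s)
    next
      case False
      then obtain s where s: "t = Suc (2 * s)" by (auto elim: oddE)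
      \<comment> \<open>As \<open>N\<close> is even,
        \<open>(-1) ^ (N + s) = (-1) ^ s\<close>.\<close>
      have "pf h (Suc (2 * (N + s))) = pf h (Suc (2 * s))"
        unfolding pf_odd using N by (simp add: power_add)
      then show ?thesis by (simp add: s)
    qed
    then show ?thesis using N by (intro exI[of _ "2 * N"]) (simp add: pf_even)
  qed
qed

text \<open>The list determines the tag, so dropping the tag is injective; the window at position 0
  adds nothing to those at positive positions.\<close>

lemma card_pf_factors:
  assumes h: "\<And>i. h i \<in> {-1, 1}" and n: "n \<ge> 7"
  shows "card (factors n (pf h)) = 4 * n"
proof -
  let ?w = "\<lambda>i. map (pf h) [i..<i + n]"
  obtain N where N: "N > 0" "pf h N = 1" "\<And>t. 0 < t \<Longrightarrow> t \<le> n \<Longrightarrow> pf h (N + t) = pf h t"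
    using pf_prefix_recurs[of h 1 n] h by auto
  have "pf h (0 + t) = pf h (N + t)" if "t < n" for t
    using N that by (cases "t = 0") auto
  then have "?w 0 = ?w N" by (simp only: window_eq_iff) blast
  then have "?w i \<in> ?w ` {1..}" for i
    using N(1) by (cases "i = 0") auto
  then have "factors n (pf h) = ?w ` {1..}"
    unfolding factors_eq_range by blast
  also have "\<dots> = snd ` pf_window h n ` {1..}"
    by (simp add: image_image pf_window_def)
  also have "card \<dots> = card (pf_window h n ` {1..})"
  proof (intro card_image inj_onI)
    fix x y assume "x \<in> pf_window h n ` {1..}" "y \<in> pf_window h n ` {1..}" "snd x = snd y"
    then obtain i j where ij: "i > 0" "j > 0" "x = pf_window h n i" "y = pf_window h n j"
      by (metis One_nat_def Suc_le_eq atLeast_iff imageE)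
    then have "?w i = ?w j" using \<open>snd x = snd y\<close> by (simp add: pf_window_def)
    then have eq: "pf h (i + t) = pf h (j + t)" if "t < n" for t
      using that unfolding window_eq_iff by blast
    have "even i \<longleftrightarrow> even j"
      using pf_window_parity[of h i j n] pf_window_parity[of h j i n] h n ij eq by auto
    then show "x = y" using ij eq by (simp add: pf_window_eq_iff)
  qed
  also have "\<dots> = 4 * n" using card_pf_windows[of h n] h n by simp
  finally show ?thesis .
qed

section \<open>Run lengths\<close>

text \<open>The sequence U of the overview. The first instruction is exceptional because the factor
  \<open>(-1) ^ Suc k\<close> in \<open>run_sign_eq\<close> is 1 for odd \<open>k\<close> and -1 for
  even \<open>k\<close>.\<close>

definition run_sign :: "(nat \<Rightarrow> int) \<Rightarrow> nat \<Rightarrow> int" where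
  "run_sign f = pf (\<lambda>k. if k = 0 then f 0 * f 1 else - f 0 * f (Suc k))"

text \<open>The value is the product of the entries at positions \<open>2 * k - 1\<close> and
  \<open>2 * k\<close>, so it tells whether they agree.\<close>

lemma run_sign_eq:
  assumes "k > 0"
  shows "run_sign f k = (-1) ^ Suc k * f 0 * pf f (2 * k)"
proof (cases "even k")
  case True
  then obtain m where m: "k = 2 * m" by (auto elim: evenE)
  then have "run_sign f k = pf (\<lambda>k. - f 0 * f (Suc (Suc k))) m"
    by (simp add: run_sign_def pf_even)
  also have "\<dots> = - f 0 * pf (\<lambda>k. f (Suc (Suc k))) m"
    using assms m by (intro pf_scale) simp
  also have "pf (\<lambda>k. f (Suc (Suc k))) m = pf f (2 * k)" by (simp only: m pf_even)
  finally show ?thesis by (simp add: m)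
next
  case False
  then obtain j where "k = Suc (2 * j)" by (auto elim: oddE)
  then show ?thesis by (simp only: run_sign_def pf_odd pf_even) simp
qed

text \<open>Start of the \<open>k\<close>-th run, with runs and entries of
  \<open>paperfold f\<close> counted from 0; \<open>run_sign f 0 = 1\<close> puts the first run at
  0.\<close>

definition run_start :: "(nat \<Rightarrow> int) \<Rightarrow> nat \<Rightarrow> nat" where
  "run_start f k = 2 * k - (if run_sign f k = 1 then 0 else 1)"

lemma strict_mono_run_start: "strict_mono (run_start f)"
  by (auto simp: strict_mono_Suc_iff run_start_def)

text \<open>With positions counted from 1, the entries at \<open>2 * k - 1\<close> and
  \<open>2 * k + 1\<close> are opposite, so exactly one of the two steps around \<open>2 * k\<close>
  is a change, and \<open>run_sign\<close> tells which.\<close>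

lemma range_run_start:
  assumes f: "\<And>i. f i \<in> {-1, 1}"
  shows "range (run_start f) = {i. i = 0 \<or> paperfold f (i - 1) \<noteq> paperfold f i}"
proof -
  have f0: "f 0 = -1 \<or> f 0 = 1" using f[of 0] by auto
  have start: "run_start f k = (if run_sign f k = 1 then 2 * k else 2 * k - 1)" for k
    by (simp add: run_start_def)
  have key: "(run_sign f k = 1 \<longleftrightarrow> pf f (2 * k) \<noteq> pf f (Suc (2 * k)))"
    "(run_sign f k = 1 \<longleftrightarrow> pf f (2 * k - 1) = pf f (2 * k))" if "k > 0" for k
  proof -
    obtain m where m: "k = Suc m" using \<open>k > 0\<close> by (cases k) auto
    have "2 * k - 1 = Suc (2 * m)" by (simp add: m)
    then have o: "pf f (2 * k - 1) = (-1) ^ m * f 0" by (simp only: pf_odd)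
    have p: "pf f (2 * k) = -1 \<or> pf f (2 * k) = 1" using pf_values[of f "2 * k", OF f] by auto
    have q: "(-1 :: int) ^ m = -1 \<or> (-1 :: int) ^ m = 1"
      by (cases "even m") auto
    show "run_sign f k = 1 \<longleftrightarrow> pf f (2 * k) \<noteq> pf f (Suc (2 * k))"
      unfolding run_sign_eq[OF that] pf_odd using f0 p q m by auto
    show "run_sign f k = 1 \<longleftrightarrow> pf f (2 * k - 1) = pf f (2 * k)"
      unfolding run_sign_eq[OF that] o using f0 p q m by auto
  qed
  show ?thesis
  proof (intro set_eqI iffI)
    fix i assume "i \<in> range (run_start f)"
    then obtain k where i: "i = run_start f k" by auto
    show "i \<in> {i. i = 0 \<or> paperfold f (i - 1) \<noteq> paperfold f i}"
    proof (cases "k = 0")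
      case True
      then show ?thesis by (simp add: i start)
    next
      case False
      then show ?thesis using key[of k] by (auto simp: i start paperfold_eq_pf)
    qed
  next
    fix i assume i: "i \<in> {i. i = 0 \<or> paperfold f (i - 1) \<noteq> paperfold f i}"
    show "i \<in> range (run_start f)"
    proof (cases "i = 0")
      case True
      then have "i = run_start f 0" by (simp add: start)
      then show ?thesis by blast
    next
      case False
      then have ne: "pf f i \<noteq> pf f (Suc i)" using i by (simp add: paperfold_eq_pf)
      show ?thesis
      proof (cases "even i")
        case True
        then obtain k where "i = 2 * k" by (auto elim: evenE)
        then have "i = run_start f k" using key(1)[of k] ne False by (simp add: start)
        then show ?thesis by blast
      next
        case odd: False
        then obtain k where "i = Suc (2 * k)" by (auto elim: oddE)
        then have "i = run_start f (Suc k)" using key(2)[of "Suc k"] ne by (simp add: start)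
        then show ?thesis by blast
      qed
    qed
  qed
qed

lemma enumerate_range_strict_mono:
  fixes g :: "nat \<Rightarrow> nat"
  assumes "strict_mono g"
  shows "enumerate (range g) k = g k"
proof (induction k)
  case 0
  have "(LEAST n. n \<in> range g) = g 0"
    using assms by (intro Least_equality) (auto simp: strict_mono_less_eq)
  then show ?case by (simp add: enumerate_0)
next
  case (Suc k)
  have inf: "infinite (range g)"
    using assms range_inj_infinite strict_mono_imp_inj_on by blast
  have "enumerate (range g) (Suc k) = (LEAST s. s \<in> range g \<and> g k < s)"
    using enumerate_Suc''[OF inf, of k] Suc by simp
  also have "\<dots> = g (Suc k)"
    using assms by (intro Least_equality) (auto simp: strict_mono_less_eq strict_mono_less)
  finally show ?case .
qed

text \<open>The sequence is not eventually constant, so every block that starts also ends.\<close>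

lemma run_starts_paperfold:
  assumes f: "\<And>i. f i \<in> {-1, 1}"
  shows "run_starts (paperfold f) = range (run_start f)"
proof -
  have "(\<exists>l. is_run (paperfold f) i l) \<longleftrightarrow> i = 0 \<or> paperfold f (i - 1) \<noteq> paperfold f i" for i
    using is_run_exists[of i "paperfold f"] paperfold_not_eventually_constant[of f i, OF f]
    unfolding is_run_def by metis
  then show ?thesis unfolding range_run_start[of f, OF f] run_starts_def by simp
qed

text \<open>The index right after a run is a change, hence a later start; the next start is itself a
  change and so cannot lie inside the run.\<close>

lemma run_lengths_paperfold:
  assumes f: "\<And>i. f i \<in> {-1, 1}"
  shows "run_lengths (paperfold f) k = run_start f (Suc k) - run_start f k"
proof -
  let ?s = "paperfold f" and ?l = "run_lengths (paperfold f) k" and ?a = "run_start f k"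
  have "is_run ?s ?a ?l"
    using is_run_run_lengths[of f k, OF f]
    by (simp add: run_starts_paperfold[of f, OF f] enumerate_range_strict_mono strict_mono_run_start)
  then have l: "0 < ?l" "\<And>d. d < ?l \<Longrightarrow> ?s (?a + d) = ?s ?a" "?s (?a + ?l) \<noteq> ?s ?a"
    by (auto simp: is_run_def)
  have less: "?a < run_start f (Suc k)"
    using strict_mono_run_start by (simp add: strict_mono_less)
  have "?s (?a + ?l - 1) = ?s ?a" using l(2)[of "?l - 1"] l(1) by simp
  then have "?a + ?l \<in> range (run_start f)"
    using l(3) unfolding range_run_start[of f, OF f] by simp
  then obtain k' where k': "?a + ?l = run_start f k'" by auto
  then have "k < k'" using l(1) strict_mono_run_start strict_mono_less by (metis less_add_same_cancel1)
  then have ge: "run_start f (Suc k) \<le> ?a + ?l"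
    using k' strict_mono_run_start by (simp add: strict_mono_less_eq)
  define d where "d = run_start f (Suc k) - ?a"
  have d: "run_start f (Suc k) = ?a + d" "d > 0" using less by (auto simp: d_def)
  have "run_start f (Suc k) \<in> range (run_start f)" by blast
  then have "?s (?a + d - 1) \<noteq> ?s (?a + d)"
    using d unfolding range_run_start[of f, OF f] by simp
  then have "\<not> d < ?l" using l(2)[of d] l(2)[of "d - 1"] d(2) by auto
  then show ?thesis using ge d by simp
qed

section \<open>From run lengths to signs\<close>

lemma run_lengths_eq_run_sign:
  assumes f: "\<And>i. f i \<in> {-1, 1}"
  shows "2 * int (run_lengths (paperfold f) k) = 4 + run_sign f (Suc k) - run_sign f k"
proof -
  let ?h = "\<lambda>k. if k = 0 then f 0 * f 1 else - f 0 * f (Suc k)"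
  have "?h i \<in> {-1, 1}" for i using f[of 0] f[of 1] f[of "Suc i"] by auto
  then have "run_sign f i \<in> {-1, 1}" for i unfolding run_sign_def by (rule pf_values)
  then have v: "run_sign f i = -1 \<or> run_sign f i = 1" for i by auto
  \<comment> \<open>At \<open>k = 0\<close> this relies on \<open>run_sign f 0 = 1\<close>. The
    claim is the difference of the formulas for \<open>Suc k\<close> and \<open>k\<close>.\<close>
  have "2 * int (run_start f k) = 4 * int k - 1 + run_sign f k" for k
  proof (cases "k = 0")
    case True
    then show ?thesis by (simp add: run_start_def run_sign_def)
  next
    case False
    then show ?thesis using v[of k] by (auto simp: run_start_def)
  qed
  from this[of k] this[of "Suc k"] show ?thesis
    unfolding run_lengths_paperfold[of f, OF f]
    using strict_mono_run_start[of f] by (simp add: of_nat_diff strict_mono_less_eq)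
qed

text \<open>Run lengths fix the differences of consecutive signs, so two sign windows with equal run
  lengths differ by a constant \<open>d\<close>. Both signs occur among the first four entries of a
  window, which forces \<open>d = 0\<close>.\<close>

lemma run_lengths_window_eq_iff:
  assumes f: "\<And>i. f i \<in> {-1, 1}" and n: "n \<ge> 3"
  shows "(\<forall>t<n. run_lengths (paperfold f) (i + t) = run_lengths (paperfold f) (j + t)) \<longleftrightarrow>
    (\<forall>t<Suc n. run_sign f (i + t) = run_sign f (j + t))" (is "?L \<longleftrightarrow> ?R")
proof
  let ?u = "run_sign f"
  note len = run_lengths_eq_run_sign[of f, OF f]
  assume L: ?L
  define d where "d = ?u i - ?u j"
  have diff: "?u (i + t) - ?u (j + t) = d" if "t \<le> n" for t
    using that
  proof (induction t)
    case 0
    then show ?case by (simp add: d_def)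
  next
    case (Suc t)
    then show ?case using L len[of "i + t"] len[of "j + t"] by simp
  qed
  have h: "(if k = 0 then f 0 * f 1 else - f 0 * f (Suc k)) \<in> {-1, 1}" for k
    using f[of 0] f[of 1] f[of "Suc k"] by auto
  have v: "?u k = -1 \<or> ?u k = 1" for k
    using pf_values[of "\<lambda>k. if k = 0 then f 0 * f 1 else - f 0 * f (Suc k)" k, OF h]
    by (auto simp: run_sign_def)
  \<comment> \<open>An odd position is at most one step away, so offset \<open>t + 2\<close> is at
    most 3 and within the range of \<open>diff\<close>.\<close>
  obtain t where t: "t \<le> 1" "odd (i + t)" by (cases "odd i") (auto intro: that[of 0] that[of 1])
  have "?u (i + t + 2) = - ?u (i + t)"
    unfolding run_sign_def by (rule pf_odd_add2) fact
  then have "d = 0"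
    using diff[of t] diff[of "t + 2"] t n v[of "i + t"] v[of "j + t"] v[of "j + t + 2"]
    by (auto simp: add.assoc)
  then show ?R using diff by auto
next
  assume R: ?R
  have "2 * int (run_lengths (paperfold f) (i + t)) = 2 * int (run_lengths (paperfold f) (j + t))"
    if "t < n" for t
    using R that spec[OF R, of "Suc t"] unfolding run_lengths_eq_run_sign[of f, OF f] by simp
  then show ?L by simp
qed

theorem theorem9:
  fixes f :: "nat \<Rightarrow> int" and n :: nat
  assumes "\<And>i. f i \<in> {-1, 1}" and "n \<ge> 6"
  shows "card (factors n (run_lengths (paperfold f))) = 4 * n + 4"
proof -
  have "\<exists>\<phi>. bij_betw \<phi> (factors n (run_lengths (paperfold f))) (factors (Suc n) (run_sign f))"
    unfolding factors_eq_range
    using run_lengths_window_eq_iff[of f n, OF assms(1)] assms(2)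
    by (intro bij_betw_images_same_kernel) (simp only: window_eq_iff)
  then have "card (factors n (run_lengths (paperfold f))) = card (factors (Suc n) (run_sign f))"
    by (auto dest: bij_betw_same_card)
  \<comment> \<open>\<open>n \<ge> 6\<close> makes the sign windows at least 7 long, as the parity
    argument requires.\<close>
  also have "\<dots> = 4 * Suc n"
    unfolding run_sign_def
  proof (rule card_pf_factors)
    show "(if k = 0 then f 0 * f 1 else - f 0 * f (Suc k)) \<in> {-1, 1}" for k
      using assms(1)[of 0] assms(1)[of 1] assms(1)[of "Suc k"] by auto
  qed (use assms(2) in simp)
  finally show ?thesis by simp
qed

end
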